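(* Let $n\in\mathbb{Z}_+$, $\mathbf{a}=(a_n,\dots,a_{2n})\in\mathbb{C}^{n+1}$, $\theta\in\mathbb{C}$, $\lambda\in\mathbb{C}^*$, $\alpha\in\mathbb{C}\setminus\{0\}$, and $h=\xi t+\eta\in\mathbb{C}[t]$ with $\xi\neq0$. Then $\Omega(\lambda,\alpha,h)\otimes V_{\mathbf{a},\theta}\cong\mathrm{Ind}_{\theta,\lambda}(\mathbb{C}[t]_{\alpha,h,\mathbf{a}})$ as $\mathrm{Vir}$-modules.
   Context: $\mathrm{Vir}$ is the Lie algebra with basis $\{d_i,c\mid i\in\mathbb{Z}\}$ and brackets $[d_i,d_j]=(j-i)d_{i+j}+\delta_{i,-j}\frac{i^3-i}{12}c$, $[c,d_i]=0$. Operators on $\mathbb{C}[t]$: $F(f)=\frac{h(t)-h(\alpha)}{t-\alpha}f(t)-f'(t)$, $G(f)=h(\alpha)f+tF(f)$. $\Omega(\lambda,\alpha,h)$ is $\mathbb{C}[t,s]$ with $c$ acting as $0$ and $d_m(f(t)s^i)=\lambda^m(s-m)^i\big(sf+mG(f)-m^2\alpha F(f)\big)$ for $m\in\mathbb{Z}$, $i\in\mathbb{Z}_+$, $f\in\mathbb{C}[t]$; tensor products carry $x(a\otimes v)=xa\otimes v+a\otimes xv$. Let $\mathrm{Vir}_+^{(n-1)}$ be the subalgebra spanned by $\{d_i\mid i\ge n\}$; make $\mathbb{C}$ a $\mathrm{Vir}_+^{(n-1)}$-module by $d_i\cdot1=a_i$ for $n\le i\le 2n$ and $d_i\cdot1=0$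 for $i>2n$, and set $V_{\mathbf{a},\theta}=U(\mathrm{Vir})\otimes_{U(\mathrm{Vir}_+^{(n-1)})}\mathbb{C}\,/\,(c-\theta)U(\mathrm{Vir})\otimes_{U(\mathrm{Vir}_+^{(n-1)})}\mathbb{C}$. Let $\mathfrak{b}_{\lambda,n+1}=\mathrm{span}\{d_k-\lambda^{k-n}d_n\mid k\ge n+1\}$ and let $\mathbb{C}[t]_{\alpha,h,\mathbf{a}}$ be $\mathbb{C}[t]$ with $\mathfrak{b}_{\lambda,n+1}$-action $(d_k-\lambda^{k-n}d_n)\circ f=(k-n)\lambda^k\big(G(f)-(k+n)\alpha F(f)\big)+(a_k-\lambda^{k-n}a_n)f$ ($a_k:=0$ for $k>2n$). Then $\mathrm{Ind}_{\theta,\lambda}(\mathbb{C}[t]_{\alpha,h,\mathbf{a}})=U(\mathrm{Vir})\otimes_{U(\mathfrak{b}_{\lambda,n+1})}\mathbb{C}[t]_{\alpha,h,\mathbf{a}}\,/\,(c-\theta)U(\mathrm{Vir})\otimes_{U(\mathfrak{b}_{\lambda,n+1})}\mathbb{C}[t]_{\alpha,h,\mathbf{a}}$. *)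

theory Defs
  imports Complex_Main "HOL-Computational_Algebra.Polynomial" "HOL-Library.Function_Algebras"
begin

definition Fop :: "complex poly \<Rightarrow> complex \<Rightarrow> complex poly \<Rightarrow> complex poly" where
  "Fop h \<alpha> f = ((h - [:poly h \<alpha>:]) div [:-\<alpha>, 1:]) * f - pderiv f"

definition Gop :: "complex poly \<Rightarrow> complex \<Rightarrow> complex poly \<Rightarrow> complex poly" where
  "Gop h \<alpha> f = smult (poly h \<alpha>) f + [:0, 1:] * Fop h \<alpha> f"

text \<open>Elements of C[t,s] are polynomials in s with coefficients in C[t]
  (type complex poly poly; outer variable s, inner variable t).
  omega_act lam alpha h m f i is the action of d_m on f(t) s^i.\<close>

definition omega_act ::
  "complex \<Rightarrow> complex \<Rightarrow> complex poly \<Rightarrow> int \<Rightarrow> complex poly \<Rightarrow> nat \<Rightarrow> complex poly poly" where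
  "omega_act lam \<alpha> h m f i =
     smult [:lam powi m:]
       ([:[:- of_int m:], 1:] ^ i *
        (monom f 1 + [: smult (of_int m) (Gop h \<alpha> f) - smult (of_int m ^ 2 * \<alpha>) (Fop h \<alpha> f) :]))"

section \<open>Tensor product Omega (x) V, modelled as finitely supported maps (a,i) \<mapsto> v,
  the element being sum of t^a s^i (x) v\<close>

definition ptw :: "'k \<Rightarrow> 'v::zero \<Rightarrow> 'k \<Rightarrow> 'v" where
  "ptw p v = (\<lambda>q. if q = p then v else 0)"

definition fin_supp :: "('k \<Rightarrow> 'v::zero) \<Rightarrow> bool" where
  "fin_supp x \<longleftrightarrow> finite {w. x w \<noteq> 0}"

definition tens :: "(complex \<Rightarrow> 'v \<Rightarrow> 'v) \<Rightarrow> complex poly poly \<Rightarrow> 'v \<Rightarrow> nat \<times> nat \<Rightarrow> 'v" where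
  "tens scV P v = (\<lambda>(b, j). scV (coeff (coeff P j) b) v)"

definition tensor_carrier :: "'v set \<Rightarrow> (nat \<times> nat \<Rightarrow> 'v::zero) set" where
  "tensor_carrier SV = {X. fin_supp X \<and> (\<forall>p. X p \<in> SV)}"

definition tensor_scale :: "(complex \<Rightarrow> 'v \<Rightarrow> 'v) \<Rightarrow> complex \<Rightarrow> (nat \<times> nat \<Rightarrow> 'v) \<Rightarrow> nat \<times> nat \<Rightarrow> 'v" where
  "tensor_scale scV c X = (\<lambda>p. scV c (X p))"

text \<open>Action of d_m on Omega (x) V: x(a (x) v) = xa (x) v + a (x) xv, extended linearly.\<close>
definition tensor_act ::
  "complex \<Rightarrow> complex \<Rightarrow> complex poly \<Rightarrow> (complex \<Rightarrow> 'v \<Rightarrow> 'v) \<Rightarrow> (int \<Rightarrow> 'v \<Rightarrow> 'v::ab_group_add)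
     \<Rightarrow> int \<Rightarrow> (nat \<times> nat \<Rightarrow> 'v) \<Rightarrow> nat \<times> nat \<Rightarrow> 'v" where
  "tensor_act lam \<alpha> h scV DV m X =
     (\<Sum>p\<in>{p. X p \<noteq> 0}.
        tens scV (omega_act lam \<alpha> h m (monom 1 (fst p)) (snd p)) (X p) + ptw p (DV m (X p)))"

text \<open>A tensor T(Vir') (x) M, where Vir' is spanned by the d_i and c has been replaced by
  the scalar theta, is modelled as finitely supported maps from words (int lists; the word
  [i1,...,ir] stands for d_i1 ... d_ir) to M.  d_i acts by prepending i.\<close>

definition prepend :: "int \<Rightarrow> (int list \<Rightarrow> 'm::zero) \<Rightarrow> int list \<Rightarrow> 'm" where
  "prepend i x = (\<lambda>w. case w of [] \<Rightarrow> 0 | j # w' \<Rightarrow> if j = i then x w' else 0)"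

text \<open>Commutation relations u (d_i d_j - d_j d_i - [d_i,d_j]) v (x) m with c = theta.\<close>
definition comm_rels ::
  "(complex \<Rightarrow> 'm \<Rightarrow> 'm) \<Rightarrow> complex \<Rightarrow> (int list \<Rightarrow> 'm::ab_group_add) set" where
  "comm_rels sc \<theta> = {ptw (u @ [i, j] @ v) m - ptw (u @ [j, i] @ v) m
        - ptw (u @ [i + j] @ v) (sc (of_int (j - i)) m)
        - (if i = - j then ptw (u @ v) (sc ((of_int i ^ 3 - of_int i) / 12 * \<theta>) m) else 0)
      | u v i j m. True}"

text \<open>Relations for V_{a,theta}: M = C with d_i 1 = a_i (n <= i <= 2n), d_i 1 = 0 (i > 2n).\<close>
definition V_rels :: "nat \<Rightarrow> (int \<Rightarrow> complex) \<Rightarrow> complex \<Rightarrow> (int list \<Rightarrow> complex) set" where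
  "V_rels n a \<theta> = comm_rels (*) \<theta>
     \<union> {ptw (u @ [i]) 1 - ptw u (a i) | u i. int n \<le> i \<and> i \<le> 2 * int n}
     \<union> {ptw (u @ [i]) 1 | u i. i > 2 * int n}"

definition a_ext :: "nat \<Rightarrow> (int \<Rightarrow> complex) \<Rightarrow> int \<Rightarrow> complex" where
  "a_ext n a k = (if k \<le> 2 * int n then a k else 0)"

text \<open>Action of d_k - lam^(k-n) d_n (k >= n+1) on C[t]_{alpha,h,a}.\<close>
definition b_act ::
  "nat \<Rightarrow> (int \<Rightarrow> complex) \<Rightarrow> complex \<Rightarrow> complex \<Rightarrow> complex poly \<Rightarrow> int \<Rightarrow> complex poly \<Rightarrow> complex poly" where
  "b_act n a lam \<alpha> h k f =
     smult (of_int (k - int n) * lam powi k) (Gop h \<alpha> f - smult (of_int (k + int n) * \<alpha>) (Fop h \<alpha> f))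
     + smult (a_ext n a k - lam powi (k - int n) * a_ext n a (int n)) f"

definition poly_scale :: "complex \<Rightarrow> (int list \<Rightarrow> complex poly) \<Rightarrow> int list \<Rightarrow> complex poly" where
  "poly_scale c x = (\<lambda>w. smult c (x w))"

definition Ind_rels ::
  "nat \<Rightarrow> (int \<Rightarrow> complex) \<Rightarrow> complex \<Rightarrow> complex \<Rightarrow> complex \<Rightarrow> complex poly \<Rightarrow> (int list \<Rightarrow> complex poly) set" where
  "Ind_rels n a \<theta> lam \<alpha> h = comm_rels smult \<theta>
     \<union> {ptw (u @ [k]) f - ptw (u @ [int n]) (smult (lam powi (k - int n)) f) - ptw u (b_act n a lam \<alpha> h k f)
        | u k f. k \<ge> int n + 1}"

text \<open>presents scT T R scW W act pi: pi is a linear surjection T -> W, with kernel span R,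
  intertwining prepending (d_i on T(Vir) (x) M) with act i on W; i.e. W, with the
  d_i acting by act, is isomorphic as a Vir-module to (the quotient) T / span R.\<close>
definition presents ::
  "(complex \<Rightarrow> 't \<Rightarrow> 't) \<Rightarrow> 't set \<Rightarrow> 't set \<Rightarrow> (complex \<Rightarrow> 'w \<Rightarrow> 'w) \<Rightarrow> 'w set
    \<Rightarrow> (int \<Rightarrow> 't \<Rightarrow> 't) \<Rightarrow> (int \<Rightarrow> 'w \<Rightarrow> 'w) \<Rightarrow> ('t::ab_group_add \<Rightarrow> 'w::ab_group_add) \<Rightarrow> bool" where
  "presents scT T R scW W actT actW \<pi> \<longleftrightarrow>
     (\<forall>x\<in>T. \<forall>y\<in>T. \<pi> (x + y) = \<pi> x + \<pi> y) \<and>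
     (\<forall>c. \<forall>x\<in>T. \<pi> (scT c x) = scW c (\<pi> x)) \<and>
     \<pi> ` T = W \<and>
     {x\<in>T. \<pi> x = 0} = module.span scT R \<and>
     (\<forall>i. \<forall>x\<in>T. \<pi> (actT i x) = actW i (\<pi> x))"

end

theory Submission
  imports Defs
begin

text \<open>The isomorphism is \<open>Ind \<rightarrow> \<Omega> \<otimes> V\<close>, \<open>w \<otimes> f \<mapsto> w (f \<otimes> 1)\<close>. Instead of comparing PBW bases, the tensor
  identity \<open>\<Omega> \<otimes> U(Vir) \<otimes> \<complex> \<cong> U(Vir) \<otimes> (\<Omega> \<otimes> \<complex>)\<close> is realised on words: an inverse is given by
  \<open>P \<otimes> d\<^sub>k w \<mapsto> d\<^sub>k (P \<otimes> w) - d\<^sub>k P \<otimes> w\<close>, starting from a map on \<open>\<Omega>\<close> that intertwines the \<open>d\<^sub>k\<close> with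
  \<open>k \<ge> n\<close>, where \<open>d\<^sub>k\<close> acts on \<open>\<Omega>\<close> twisted by \<open>a\<^sub>k\<close>. The latter exists because \<open>\<Omega>\<close> is spanned freely
  over \<open>\<complex>[t]\<close> by the powers of the twisted \<open>d\<^sub>n\<close>, whose leading term multiplies by \<open>\<lambda>\<^sup>n s\<close>.\<close>

section \<open>Finitely supported functions\<close>

lemma ptw_0 [simp]: "ptw w 0 = 0"
  by (auto simp: ptw_def fun_eq_iff)

lemma ptw_add: "ptw w (m + m') = ptw w m + ptw w (m' :: 'm::monoid_add)"
  by (auto simp: ptw_def fun_eq_iff)

lemma fin_supp_0 [simp]: "fin_supp 0"
  by (simp add: fin_supp_def)

lemma fin_supp_ptw [simp]: "fin_supp (ptw w m)"
  unfolding fin_supp_def by (rule finite_subset[of _ "{w}"]) (auto simp: ptw_def)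

lemma fin_supp_add [simp]: "fin_supp x \<Longrightarrow> fin_supp y \<Longrightarrow> fin_supp (x + y)"
  for x y :: "'k \<Rightarrow> 'm::monoid_add"
  unfolding fin_supp_def by (rule finite_subset[of _ "{w. x w \<noteq> 0} \<union> {w. y w \<noteq> 0}"]) auto

lemma fin_supp_diff [simp]: "fin_supp x \<Longrightarrow> fin_supp y \<Longrightarrow> fin_supp (x - y)"
  for x y :: "'k \<Rightarrow> 'm::ab_group_add"
  unfolding fin_supp_def by (rule finite_subset[of _ "{w. x w \<noteq> 0} \<union> {w. y w \<noteq> 0}"]) auto

lemma fin_supp_comp [simp]: "fin_supp x \<Longrightarrow> g 0 = 0 \<Longrightarrow> fin_supp (\<lambda>w. g (x w))"
  unfolding fin_supp_def by (rule finite_subset[of _ "{w. x w \<noteq> 0}"]) auto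

lemma fin_supp_sum [simp]: "(\<And>i. i \<in> S \<Longrightarrow> fin_supp (x i)) \<Longrightarrow> fin_supp (\<Sum>i\<in>S. x i)"
  for x :: "'i \<Rightarrow> 'k \<Rightarrow> 'm::ab_group_add"
  by (induction S rule: infinite_finite_induct) auto

lemma fin_supp_induct [consumes 1, case_names zero ptw add]:
  fixes x :: "'k \<Rightarrow> 'm::ab_group_add"
  assumes "fin_supp x" and zero: "P 0" and ptw: "\<And>w m. P (ptw w m)"
    and add: "\<And>x y. fin_supp x \<Longrightarrow> fin_supp y \<Longrightarrow> P x \<Longrightarrow> P y \<Longrightarrow> P (x + y)"
  shows "P x"
proof -
  \<comment> \<open>The induction runs over a finite superset \<open>S\<close> of the support:
    clearing the value at \<open>w\<close> leaves a function supported in the smaller set, whether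
    or not \<open>w\<close> belonged to the support.\<close>
  have "P x" if "finite S" "{w. x w \<noteq> 0} \<subseteq> S" for S and x :: "'k \<Rightarrow> 'm"
    using that
  proof (induction S arbitrary: x rule: finite_induct)
    case empty
    then have "x = 0" by (auto simp: fun_eq_iff)
    then show ?case by (simp only: zero)
  next
    case (insert w S)
    let ?y = "x - ptw w (x w)"
    have sub: "{v. ?y v \<noteq> 0} \<subseteq> S"
      using insert.prems by (auto simp: ptw_def)
    then have "fin_supp ?y"
      using insert.hyps finite_subset unfolding fin_supp_def by blast
    then have "P (ptw w (x w) + ?y)"
      by (intro add insert.IH sub ptw) auto
    then show ?case by simp
  qed
  then show ?thesis using assms(1) unfolding fin_supp_def by blast
qed

section \<open>Linear extension from single points\<close>

definition lin_ext :: "('k \<Rightarrow> 'm::ab_group_add \<Rightarrow> 'b::ab_group_add) \<Rightarrow> ('k \<Rightarrow> 'm) \<Rightarrow> 'b" where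
  "lin_ext L x = (\<Sum>w\<in>{w. x w \<noteq> 0}. L w (x w))"

text \<open>Points outside the support contribute \<open>L w 0 = 0\<close>, so one index set can
  serve several functions with different supports; additivity of \<open>lin_ext\<close> rests on
  this.\<close>

lemma lin_ext_superset:
  assumes "\<And>w. additive (L w)" "finite S" "{w. x w \<noteq> 0} \<subseteq> S"
  shows "lin_ext L x = (\<Sum>w\<in>S. L w (x w))"
  unfolding lin_ext_def using assms
  by (intro sum.mono_neutral_left) (auto simp: additive.zero)

lemma lin_ext_0 [simp]: "lin_ext L 0 = 0"
  by (simp add: lin_ext_def)

lemma lin_ext_add:
  assumes "\<And>w. additive (L w)" "fin_supp x" "fin_supp y"
  shows "lin_ext L (x + y) = lin_ext L x + lin_ext L y"
proof -
  let ?S = "{w. x w \<noteq> 0} \<union> {w. y w \<noteq> 0}"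
  have fin: "finite ?S" using assms by (simp add: fin_supp_def)
  have "lin_ext L (x + y) = (\<Sum>w\<in>?S. L w ((x + y) w))"
    by (rule lin_ext_superset[OF assms(1) fin]) auto
  also have "\<dots> = (\<Sum>w\<in>?S. L w (x w)) + (\<Sum>w\<in>?S. L w (y w))"
    using assms(1) by (simp add: additive.add sum.distrib)
  also have "(\<Sum>w\<in>?S. L w (x w)) = lin_ext L x"
    by (rule lin_ext_superset[OF assms(1) fin, symmetric]) auto
  also have "(\<Sum>w\<in>?S. L w (y w)) = lin_ext L y"
    by (rule lin_ext_superset[OF assms(1) fin, symmetric]) auto
  finally show ?thesis .
qed

lemma lin_ext_diff:
  assumes "\<And>w. additive (L w)" "fin_supp x" "fin_supp y"
  shows "lin_ext L (x - y) = lin_ext L x - lin_ext L y"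
  using lin_ext_add[of L "x - y" y] assms by (simp add: algebra_simps)

lemma lin_ext_sum:
  assumes "\<And>w. additive (L w)" "\<And>i. i \<in> S \<Longrightarrow> fin_supp (x i)"
  shows "lin_ext L (\<Sum>i\<in>S. x i) = (\<Sum>i\<in>S. lin_ext L (x i))"
  using assms(2) by (induction S rule: infinite_finite_induct) (auto simp: lin_ext_add assms(1))

lemma lin_ext_ptw:
  assumes "\<And>w. additive (L w)"
  shows "lin_ext L (ptw w m) = L w m"
  by (subst lin_ext_superset[of _ "{w}"]) (auto simp: assms ptw_def)

lemma lin_ext_scale:
  assumes "\<And>w. additive (L w)" "additive g" "\<And>w m. L w (f m) = g (L w m)" "fin_supp x" "f 0 = 0"
  shows "lin_ext L (\<lambda>w. f (x w)) = g (lin_ext L x)"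
proof -
  have "lin_ext L (\<lambda>w. f (x w)) = (\<Sum>w\<in>{w. x w \<noteq> 0}. L w (f (x w)))"
    using assms by (intro lin_ext_superset) (auto simp: fin_supp_def)
  also have "\<dots> = g (lin_ext L x)"
    unfolding lin_ext_def additive.sum[OF assms(2)] using assms(3) by simp
  finally show ?thesis .
qed

lemma sum_fun_apply: "(\<Sum>i\<in>S. f i) x = (\<Sum>i\<in>S. f i x)"
  for f :: "'i \<Rightarrow> 'a \<Rightarrow> 'b::comm_monoid_add"
  by (induction S rule: infinite_finite_induct) auto

section \<open>Words and left multiplication by a generator\<close>

lemma prepend_Nil [simp]: "prepend i x [] = 0"
  by (simp add: prepend_def)

lemma prepend_Cons [simp]: "prepend i x (j # w) = (if j = i then x w else 0)"
  by (simp add: prepend_def)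

lemma fun_eq_words:
  assumes "x [] = y []" "\<And>j w. x (j # w) = y (j # w)" shows "x = y"
  using assms by (metis ext list.exhaust)

lemma prepend_ptw: "prepend i (ptw w m) = ptw (i # w) m"
  by (rule fun_eq_words) (auto simp: ptw_def)

lemma prepend_0 [simp]: "prepend i 0 = 0"
  by (rule fun_eq_words) auto

lemma prepend_add: "prepend i (x + y) = prepend i x + prepend i (y :: _ \<Rightarrow> 'm::ab_group_add)"
  by (rule fun_eq_words) auto

lemma prepend_diff: "prepend i (x - y) = prepend i x - prepend i (y :: _ \<Rightarrow> 'm::ab_group_add)"
  by (rule fun_eq_words) auto

lemma prepend_comp: "g 0 = 0 \<Longrightarrow> prepend i (\<lambda>w. g (x w)) = (\<lambda>w. g (prepend i x w))"
  by (rule fun_eq_words) auto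

lemma fin_supp_prepend [simp]: "fin_supp (prepend i x)" if "fin_supp x"
proof -
  have "{w. prepend i x w \<noteq> 0} \<subseteq> (#) i ` {w. x w \<noteq> 0}"
  proof
    fix w assume "w \<in> {w. prepend i x w \<noteq> 0}"
    then show "w \<in> (#) i ` {w. x w \<noteq> 0}" by (cases w) (auto split: if_splits)
  qed
  then show ?thesis using that finite_subset unfolding fin_supp_def by blast
qed

text \<open>As simplification rules these would turn sums of functions into abstractions, hiding them from the
  linearity lemmas.\<close>

lemmas fun_apply = plus_fun_apply zero_fun_apply minus_apply

declare fun_apply [simp del]

lemma module_fun: "module sc \<Longrightarrow> module (\<lambda>c x w. sc c (x w))"
  by unfold_locales (auto simp: module_def fun_eq_iff fun_apply)

interpretation cw: module "\<lambda>c (x :: int list \<Rightarrow> complex) w. c * x w"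
  by (rule module_fun) (unfold_locales, auto simp: algebra_simps)

interpretation pw: module poly_scale
proof -
  have "module (\<lambda>c (x :: int list \<Rightarrow> complex poly) w. smult c (x w))"
    by (rule module_fun) (unfold_locales, auto simp: smult_add_right smult_add_left)
  then show "module poly_scale" by (simp add: poly_scale_def[abs_def])
qed

lemma (in module) span_image_subset:
  assumes "f 0 = 0" "\<And>x y. f (x + y) = f x + f y" "\<And>c x. f (scale c x) = scale c (f x)"
    and "f ` R \<subseteq> span R"
  shows "x \<in> span R \<Longrightarrow> f x \<in> span R"
  by (induction rule: span_induct_alt)
    (use assms in \<open>auto simp: span_zero intro!: span_add span_scale\<close>)

section \<open>Commutation relations on words\<close>

definition comm_rel ::
  "(complex \<Rightarrow> 'm \<Rightarrow> 'm) \<Rightarrow> complex \<Rightarrow> int \<Rightarrow> int \<Rightarrow> (int list \<Rightarrow> 'm::ab_group_add) \<Rightarrow> int list \<Rightarrow> 'm" where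
  "comm_rel sc \<theta> i j x = prepend i (prepend j x) - prepend j (prepend i x)
     - prepend (i + j) (\<lambda>w. sc (of_int (j - i)) (x w))
     - (if i = - j then (\<lambda>w. sc ((of_int i ^ 3 - of_int i) / 12 * \<theta>) (x w)) else 0)"

lemma ptw_comp: "g 0 = 0 \<Longrightarrow> (\<lambda>w. g (ptw v m w)) = ptw v (g m)"
  by (auto simp: ptw_def)

text \<open>An element of \<open>comm_rels\<close> is \<open>comm_rel\<close> of a single word with
  a prefix \<open>u\<close> put in front letter by letter. Closure under \<open>prepend\<close> thus
  reduces everything to relations at the left end.\<close>

lemma comm_rels_subset:
  assumes sc: "module sc"
    and "\<And>k x. x \<in> K \<Longrightarrow> prepend k x \<in> K"
    and "\<And>i j v m. comm_rel sc \<theta> i j (ptw v m) \<in> K"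
  shows "comm_rels sc \<theta> \<subseteq> K"
proof -
  interpret module sc by fact
  have "ptw (u @ [i, j] @ v) m - ptw (u @ [j, i] @ v) m
        - ptw (u @ [i + j] @ v) (sc (of_int (j - i)) m)
        - (if i = - j then ptw (u @ v) (sc ((of_int i ^ 3 - of_int i) / 12 * \<theta>) m) else 0) \<in> K"
    for u v i j m
  proof (induction u)
    case Nil
    then show ?case
      using assms(3)[of i j v m] unfolding comm_rel_def
      by (simp only: ptw_comp prepend_ptw scale_zero_right append_Nil append_Cons)
  next
    case (Cons k u)
    from assms(2)[OF Cons, of k] show ?case
      by (simp add: prepend_diff prepend_ptw split: if_splits)
  qed
  then show ?thesis unfolding comm_rels_def by blast
qed

lemma comm_rel_in_comm_rels:
  assumes "module sc"
  shows "comm_rel sc \<theta> i j (ptw v m) \<in> comm_rels sc \<theta>"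
proof -
  interpret module sc by fact
  have "comm_rel sc \<theta> i j (ptw v m) = ptw ([] @ [i, j] @ v) m - ptw ([] @ [j, i] @ v) m
        - ptw ([] @ [i + j] @ v) (sc (of_int (j - i)) m)
        - (if i = - j then ptw ([] @ v) (sc ((of_int i ^ 3 - of_int i) / 12 * \<theta>) m) else 0)"
    by (simp add: comm_rel_def ptw_comp prepend_ptw)
  then show ?thesis unfolding comm_rels_def by blast
qed

lemma prepend_comm_rels: "x \<in> comm_rels sc \<theta> \<Longrightarrow> prepend k x \<in> comm_rels sc \<theta>"
proof -
  assume "x \<in> comm_rels sc \<theta>"
  then obtain u v i j m where x: "x = ptw (u @ [i, j] @ v) m - ptw (u @ [j, i] @ v) m
        - ptw (u @ [i + j] @ v) (sc (of_int (j - i)) m)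
        - (if i = - j then ptw (u @ v) (sc ((of_int i ^ 3 - of_int i) / 12 * \<theta>) m) else 0)"
    unfolding comm_rels_def mem_Collect_eq by (elim exE conjE)
  have "prepend k x = ptw ((k # u) @ [i, j] @ v) m - ptw ((k # u) @ [j, i] @ v) m
        - ptw ((k # u) @ [i + j] @ v) (sc (of_int (j - i)) m)
        - (if i = - j then ptw ((k # u) @ v) (sc ((of_int i ^ 3 - of_int i) / 12 * \<theta>) m) else 0)"
    unfolding x by (simp add: prepend_diff prepend_ptw)
  then show ?thesis unfolding comm_rels_def by blast
qed

lemma comm_rel_add:
  assumes "module sc"
  shows "comm_rel sc \<theta> i j (x + y) = comm_rel sc \<theta> i j x + comm_rel sc \<theta> i j y"
proof -
  interpret module sc by fact
  have "(\<lambda>w. sc c ((x + y) w)) = (\<lambda>w. sc c (x w)) + (\<lambda>w. sc c (y w))" for c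
    by (auto simp: scale_right_distrib fun_apply)
  then show ?thesis
    by (simp add: comm_rel_def prepend_add)
qed

lemma fin_supp_comm_rel:
  assumes "module sc" "fin_supp x"
  shows "fin_supp (comm_rel sc \<theta> i j x)"
proof -
  interpret module sc by fact
  have "fin_supp (if b then (\<lambda>w. sc c (x w)) else 0)" for b c
    using assms(2) by simp
  then show ?thesis
    unfolding comm_rel_def using assms(2) by (intro fin_supp_diff fin_supp_prepend) simp_all
qed

text \<open>The relations are listed on single words; additivity of \<open>comm_rel\<close> carries
  them to every finitely supported \<open>x\<close>, such as the later images
  \<open>phiO P\<close>.\<close>

lemma comm_rel_in_span:
  assumes sc: "module sc" and R: "comm_rels sc \<theta> \<subseteq> R" and x: "fin_supp x"
  shows "comm_rel sc \<theta> i j x \<in> module.span (\<lambda>c x w. sc c (x w)) R"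
proof -
  interpret module sc by fact
  interpret f: module "\<lambda>c x w. sc c (x w)" by (rule module_fun) fact
  show ?thesis
    using x
  proof (induction rule: fin_supp_induct)
    case zero
    have "comm_rel sc \<theta> i j 0 = 0"
      using comm_rel_add[OF sc, of \<theta> i j 0 0] by simp
    then show ?case by (simp add: f.span_zero)
  next
    case (ptw w m)
    then show ?case using comm_rel_in_comm_rels[OF sc] R by (intro f.span_base) auto
  next
    case (add x y)
    then show ?case by (simp add: comm_rel_add[OF sc] f.span_add)
  qed
qed

section \<open>The modules \<open>\<Omega>\<close>\<close>

locale omega =
  fixes lam \<alpha> :: complex and h :: "complex poly"
  assumes lam: "lam \<noteq> 0"
begin

definition A :: "int \<Rightarrow> complex poly \<Rightarrow> complex poly" where
  "A m f = smult (of_int m) (Gop h \<alpha> f) - smult (of_int m ^ 2 * \<alpha>) (Fop h \<alpha> f)"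

definition low :: "int \<Rightarrow> complex poly poly \<Rightarrow> complex poly poly" where
  "low m P = map_poly (A m) P"

definition sh :: "int \<Rightarrow> complex poly poly \<Rightarrow> complex poly poly" where
  "sh m P = pcompose P [:[:- of_int m:], 1:]"

text \<open>The complex linear extension of \<open>omega_act\<close> to all of C[t,s], as
  \<open>D_monom\<close> confirms: the factor \<open>(s - m)^i\<close> is a substitution, which
  makes sense for every polynomial.\<close>

definition D :: "int \<Rightarrow> complex poly poly \<Rightarrow> complex poly poly" where
  "D m P = smult [:lam powi m:] (pCons 0 (sh m P) + low m (sh m P))"

lemma A_0 [simp]: "A m 0 = 0"
  by (simp add: A_def Gop_def Fop_def)

text \<open>Displays \<open>A m\<close> as a first-order differential operator in t with polynomial
  coefficients. The quotient in \<open>Fop\<close> enters as one polynomial \<open>q\<close>, so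
  commutators reduce to ring identities.\<close>

lemma A_alt:
  fixes m f
  defines "q \<equiv> (h - [:poly h \<alpha>:]) div [:-\<alpha>, 1:]" and "w \<equiv> of_int m * [:0, 1:] - of_int m ^ 2 * [:\<alpha>:]"
  shows "A m f = (of_int m * [:poly h \<alpha>:] + w * q) * f - w * pderiv f"
proof -
  have s: "smult (of_int m) g = of_int m * g" "smult (of_int m ^ 2 * \<alpha>) g = of_int m ^ 2 * [:\<alpha>:] * g"
    "smult (poly h \<alpha>) g = [:poly h \<alpha>:] * g" for g
    by (simp_all add: of_int_poly power2_eq_square mult_ac)
  show ?thesis
    unfolding A_def Gop_def Fop_def s q_def[symmetric] w_def by (simp only: algebra_simps)
qed

lemma A_add: "A m (f + g) = A m f + A m g"
  unfolding A_alt pderiv_add by (simp only: algebra_simps)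

lemma A_smult: "A m (smult c f) = smult c (A m f)"
  unfolding A_alt pderiv_smult by (simp only: mult_smult_right smult_diff_right)

text \<open>What the bracket of the operators \<open>D\<close> demands of the terms free of s. The
  two uncomposed terms arise because substituting \<open>s - m\<close> also hits the factor s
  produced by the inner operator.\<close>

lemma A_comm:
  "smult (of_int k) (A k f) - smult (of_int m) (A m f) + A m (A k f) - A k (A m f)
    = smult (of_int (k - m)) (A (m + k) f)"
proof -
  define q where "q = (h - [:poly h \<alpha>:]) div [:-\<alpha>, 1:]"
  define W where "W m = of_int m * [:0, 1:] - of_int m ^ 2 * [:\<alpha>:]" for m
  define U where "U m = of_int m * [:poly h \<alpha>:] + W m * q" for m
  have A: "A m f = U m * f - W m * pderiv f" for m f
    unfolding A_alt U_def W_def q_def ..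
  have s: "smult (of_int m) g = of_int m * g" for m and g :: "complex poly"
    by (simp add: of_int_poly)
  have dW: "pderiv (W m) = of_int m" for m
    by (simp add: W_def pderiv_diff pderiv_mult pderiv_pCons of_int_poly power2_eq_square)
  have dU: "pderiv (U m) = of_int m * q + W m * pderiv q" for m
    by (simp add: U_def pderiv_add pderiv_mult dW of_int_poly pderiv_pCons)
  \<comment> \<open>Scalars, t and the derivatives of \<open>f\<close> and \<open>q\<close> become
    independent variables; an identity in a commutative ring remains.\<close>
  define P where "P = [:poly h \<alpha>:]"
  define T where "T = [:0, 1::complex:]"
  define B where "B = [:\<alpha>:]"
  define F where "F = pderiv f"
  define F2 where "F2 = pderiv (pderiv f)"
  define Q where "Q = pderiv q"
  show ?thesis
    unfolding s A pderiv_diff pderiv_mult dW dU F_def[symmetric] F2_def[symmetric] Q_def[symmetric]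
    unfolding F_def pderiv_mult F2_def[symmetric]
    unfolding F_def[symmetric] U_def W_def P_def[symmetric] T_def[symmetric] B_def[symmetric]
      of_int_add of_int_diff
    by algebra
qed

lemma coeff_low: "coeff (low m P) i = A m (coeff P i)"
  by (simp add: low_def coeff_map_poly)

lemma low_add: "low m (P + Q) = low m P + low m Q"
  by (simp add: poly_eq_iff coeff_low A_add)

lemma low_smult: "low m (smult [:c:] P) = smult [:c:] (low m P)"
  by (simp add: poly_eq_iff coeff_low A_smult)

lemma low_pCons: "low m (pCons c P) = pCons (A m c) (low m P)"
  by (simp add: poly_eq_iff coeff_low coeff_pCons split: nat.split)

lemma low_0 [simp]: "low m 0 = 0"
  by (simp add: low_def)

lemma low_diff: "low m (P - Q) = low m P - low m Q"
  using low_add[of m "P - Q" Q] by (simp add: algebra_simps)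

lemma low_comm:
  "smult [:of_int k:] (low k P) - smult [:of_int m:] (low m P) + low m (low k P) - low k (low m P)
    = smult [:of_int (k - m):] (low (m + k) P)"
  by (rule poly_eqI) (simp add: coeff_low A_comm[unfolded of_int_diff])

lemma sh_0 [simp]: "sh m 0 = 0"
  by (simp add: sh_def)

lemma sh_add: "sh m (P + Q) = sh m P + sh m Q"
  by (simp add: sh_def pcompose_add)

lemma sh_smult: "sh m (smult c P) = smult c (sh m P)"
  by (simp add: sh_def pcompose_smult)

lemma sh_pCons: "sh m (pCons c P) = [:c:] + pCons 0 (sh m P) - smult [:of_int m:] (sh m P)"
  by (simp add: sh_def pcompose_pCons poly_eq_iff coeff_pCons split: nat.split)

lemma sh_sh: "sh m (sh k P) = sh (m + k) P"
  by (simp add: sh_def pcompose_assoc[symmetric] pcompose_pCons algebra_simps)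

lemma sh_id [simp]: "sh 0 P = P"
  by (simp add: sh_def pcompose_idR)

text \<open>The shift combines coefficients with complex scalars only, and \<open>A m\<close> is
  complex linear.\<close>

lemma low_sh: "low m (sh k P) = sh k (low m P)"
  by (induction P) (simp_all add: sh_pCons low_pCons low_add low_diff low_smult)

lemma D_0 [simp]: "D m 0 = 0"
  by (simp add: D_def)

lemma pCons_0_add: "pCons 0 (P + Q) = pCons 0 P + pCons 0 Q"
  for P Q :: "complex poly poly"
  by simp

lemma D_add: "D m (P + Q) = D m P + D m Q"
  unfolding D_def sh_add low_add pCons_0_add smult_add_right by (simp only: add_ac)

lemma D_smult: "D m (smult [:c:] P) = smult [:c:] (D m P)"
  by (simp add: D_def sh_smult low_smult smult_add_right mult_ac)

text \<open>This makes \<open>\<Omega>\<close> a Vir-module on which c acts as 0. Both compositions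
  are written through the same shifted polynomial \<open>S\<close>; the terms free of s then match
  by \<open>low_comm\<close>.\<close>

lemma D_comm: "D m (D k P) - D k (D m P) = smult [:of_int (k - m):] (D (m + k) P)"
proof -
  define S where "S = sh (m + k) P"
  have s: "smult [:of_int m:] R = of_int m * R" for m and R :: "complex poly poly"
    by (simp add: of_int_poly)
  define c where "c m = [:[:lam powi m:]:]" for m
  have c: "smult [:lam powi m:] R = c m * R" for m R
    by (simp add: c_def)
  define X where "X = [:0, 1 :: complex poly:]"
  have X: "pCons 0 R = X * R" for R
    by (simp add: X_def)
  have DD: "D m (D k P) = c m * c k * (X * (X * S - of_int m * S + low k S)
      + X * low m S - of_int m * low m S + low m (low k S))" if "sh (m + k) P = S" for m k
  proof -
    have 1: "sh m (D k P) = c k * (X * S - of_int m * S + low k S)"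
      unfolding c[symmetric] s[symmetric] X[symmetric]
      by (simp add: D_def sh_smult sh_add sh_pCons sh_sh that flip: low_sh)
    have 2: "low m (sh m (D k P)) = c k * (X * low m S - of_int m * low m S + low m (low k S))"
      unfolding 1 c[symmetric]
      by (simp add: low_smult low_add low_diff low_pCons flip: X s)
    show ?thesis
      unfolding D_def[of m] 2 unfolding 1 c X by (simp only: algebra_simps)
  qed
  have cc: "c (m + k) = c m * c k"
    using lam by (simp add: c_def power_int_add)
  have "D (m + k) P = c m * c k * (X * S + low (m + k) S)"
    unfolding D_def c X S_def[symmetric] cc ..
  moreover have "D m (D k P) = c m * c k * (X * (X * S - of_int m * S + low k S)
      + X * low m S - of_int m * low m S + low m (low k S))"
    by (rule DD) (simp add: S_def)
  moreover have "D k (D m P) = c k * c m * (X * (X * S - of_int k * S + low m S)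
      + X * low k S - of_int k * low k S + low k (low m S))"
    by (rule DD) (simp add: S_def add.commute)
  moreover have "of_int k * low k S - of_int m * low m S + low m (low k S) - low k (low m S)
      = (of_int k - of_int m) * low (m + k) S"
    using low_comm[of k S m] unfolding s by simp
  ultimately show ?thesis
    unfolding s unfolding of_int_diff by algebra
qed

lemma D_monom: "D m (monom f i) = omega_act lam \<alpha> h m f i"
proof -
  have sh: "sh m (monom f i) = smult f ([:[:- of_int m:], 1:] ^ i)" for f
    by (induction i)
      (simp_all add: sh_def monom_0 monom_Suc pcompose_pCons mult_smult_right)
  have low: "low m (sh m (monom f i)) = smult (A m f) ([:[:- of_int m:], 1:] ^ i)"
    unfolding low_sh by (simp add: low_def map_poly_monom sh)
  have "pCons 0 (smult f R) + smult (A m f) R = R * (monom f 1 + [:A m f:])" for R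
    by (simp add: monom_altdef distrib_left)
  then show ?thesis
    unfolding D_def omega_act_def A_def[symmetric] low unfolding sh by simp
qed

lemma D_const: "D m [:f:] = smult [:lam powi m:] [:A m f, f:]"
  by (simp add: D_def sh_def low_pCons)

end

section \<open>The map into the induced module\<close>

locale omega_ind = omega lam \<alpha> h for lam \<alpha> h +
  fixes n :: nat and a :: "int \<Rightarrow> complex" and \<theta> :: complex
begin

abbreviation "wt \<equiv> a_ext n a"
abbreviation "I \<equiv> pw.span (Ind_rels n a \<theta> lam \<alpha> h)"

section \<open>The twisted operator \<open>d_n\<close> and reduction of the s-degree\<close>

definition T :: "complex poly poly \<Rightarrow> complex poly poly" where
  "T P = D (int n) P + smult [:wt (int n):] P"

text \<open>Shifting \<open>Q\<close> by n restores \<open>P\<close>, so \<open>T Q\<close> is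
  \<open>lam^n (s P + low (int n) P)\<close> plus the weight term. Solving for \<open>s P\<close>
  leaves, apart from \<open>T\<close>, only polynomials of s-degree at most that of
  \<open>P\<close>.\<close>

lemma pCons_T:
  fixes P defines "Q \<equiv> sh (- int n) P"
  shows "pCons c P = [:c:] + smult [:inverse (lam powi int n):] (T Q - smult [:wt (int n):] Q)
    - low (int n) P"
  using lam by (simp add: T_def D_def Q_def sh_sh pCons_one)

lemma degree_low: "degree (low m P) \<le> degree P"
  by (rule degree_le) (auto simp: coeff_low coeff_eq_0)

lemma degree_sh: "degree (sh m P) \<le> degree P"
  unfolding sh_def using degree_pcompose_le[of P "[:[:- of_int m:], 1:]"] by simp

text \<open>Strong induction on the s-degree through \<open>pCons_T\<close>, since neither
  \<open>sh\<close> nor \<open>low\<close> raises it. In other words, C[t] generates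
  \<open>\<Omega>\<close> under \<open>T\<close>.\<close>

lemma T_induct [case_names const add smult T]:
  assumes const: "\<And>f. J [:f:]" and add: "\<And>P Q. J P \<Longrightarrow> J Q \<Longrightarrow> J (P + Q)"
    and smult: "\<And>c P. J P \<Longrightarrow> J (smult [:c:] P)" and T: "\<And>P. J P \<Longrightarrow> J (T P)"
  shows "J P"
proof (induction "degree P" arbitrary: P rule: less_induct)
  case less
  obtain c P' where P: "P = pCons c P'" by (cases P)
  have diff: "J (Q - R)" if "J Q" "J R" for Q R
  proof -
    have "Q + smult [:-1:] R = Q - R" by (simp add: poly_eq_iff)
    with add[OF that(1) smult[OF that(2), of "-1"]] show ?thesis by (rule back_subst)
  qed
  show ?case
  proof (cases "P' = 0")
    case True
    then show ?thesis using const P by simp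
  next
    case False
    then have deg: "degree P' < degree P" by (simp add: P)
    have J: "J (sh (- int n) P')" "J (low (int n) P')"
      by (auto intro!: less le_less_trans[OF degree_sh] le_less_trans[OF degree_low] deg)
    show ?thesis
      unfolding P by (subst pCons_T) (intro diff add smult const T J)
  qed
qed

text \<open>On polynomials of \<open>s\<close>-degree at most \<open>N\<close>, \<open>phi0 N\<close> sends \<open>T\<^sup>i f\<close> to \<open>d\<^sub>n\<^sup>i \<otimes> f\<close>; the recursion
  comes from \<open>pCons_T\<close>.\<close>

primrec phi0 :: "nat \<Rightarrow> complex poly poly \<Rightarrow> int list \<Rightarrow> complex poly" where
  "phi0 0 P = ptw [] (coeff P 0)"
| "phi0 (Suc N) P = ptw [] (coeff P 0)
     + poly_scale (inverse (lam powi int n))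
         (prepend (int n) (phi0 N (sh (- int n) (poly_shift 1 P)))
          - poly_scale (wt (int n)) (phi0 N (sh (- int n) (poly_shift 1 P))))
     - phi0 N (low (int n) (poly_shift 1 P))"

lemma poly_shift_add: "poly_shift m (P + Q) = poly_shift m P + poly_shift m Q"
  by (simp add: poly_eq_iff coeff_poly_shift)

lemma poly_shift_smult: "poly_shift m (smult c P) = smult c (poly_shift m P)"
  by (simp add: poly_eq_iff coeff_poly_shift)

lemma phi0_add: "phi0 N (P + Q) = phi0 N P + phi0 N Q"
  by (induction N arbitrary: P Q)
    (simp_all add: ptw_add poly_shift_add sh_add low_add prepend_add pw.scale_right_distrib
      pw.scale_right_diff_distrib)

lemma prepend_poly_scale: "prepend k (poly_scale c x) = poly_scale c (prepend k x)"
  unfolding poly_scale_def by (rule prepend_comp) simp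

lemma poly_scale_ptw: "poly_scale c (ptw w f) = ptw w (smult c f)"
  unfolding poly_scale_def by (rule ptw_comp) simp

lemma fin_supp_poly_scale [simp]: "fin_supp x \<Longrightarrow> fin_supp (poly_scale c x)"
  by (simp add: poly_scale_def)

lemma phi0_smult: "phi0 N (smult [:c:] P) = poly_scale c (phi0 N P)"
  by (induction N arbitrary: P)
    (simp_all add: poly_scale_ptw poly_shift_smult sh_smult low_smult prepend_poly_scale
      pw.scale_right_distrib pw.scale_right_diff_distrib mult_ac)

lemma phi0_0 [simp]: "phi0 N 0 = 0"
  using phi0_add[of N 0 0] by simp

text \<open>The bound \<open>N\<close> is only fuel: beyond the degree it changes nothing.
  Polynomials of different degrees can therefore be compared at a common bound, as additivity of
  \<open>phiO\<close> requires.\<close>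

lemma phi0_Suc: "degree P \<le> N \<Longrightarrow> phi0 (Suc N) P = phi0 N P"
proof (induction N arbitrary: P)
  case 0
  then have "poly_shift 1 P = 0"
    by (auto simp: poly_eq_iff coeff_poly_shift coeff_eq_0)
  then show ?case by simp
next
  case (Suc N)
  have "degree (poly_shift 1 P) \<le> N"
    by (rule degree_le) (use Suc.prems in \<open>auto simp: coeff_poly_shift coeff_eq_0\<close>)
  then have "phi0 (Suc N) (sh m (poly_shift 1 P)) = phi0 N (sh m (poly_shift 1 P))"
    "phi0 (Suc N) (low m (poly_shift 1 P)) = phi0 N (low m (poly_shift 1 P))" for m
    using degree_sh degree_low order_trans by (blast intro: Suc.IH)+
  then show ?case
    by (simp only: phi0.simps(2)[of "Suc N"] phi0.simps(2)[of N P])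
qed

definition phiO :: "complex poly poly \<Rightarrow> int list \<Rightarrow> complex poly" where
  "phiO P = phi0 (degree P) P"

lemma phi0_eq_phiO: "degree P \<le> N \<Longrightarrow> phi0 N P = phiO P"
  unfolding phiO_def by (induction N rule: dec_induct) (auto simp: phi0_Suc simp del: phi0.simps)

lemma phiO_add: "phiO (P + Q) = phiO P + phiO Q"
proof -
  let ?N = "max (degree P) (degree Q)"
  have "degree (P + Q) \<le> ?N" by (rule degree_add_le_max)
  then show ?thesis using phi0_add[of ?N P Q] by (simp add: phi0_eq_phiO)
qed

lemma phiO_smult: "phiO (smult [:c:] P) = poly_scale c (phiO P)"
  using phi0_smult[of "degree P" c P] by (simp add: phi0_eq_phiO degree_smult_le)

lemma phiO_0 [simp]: "phiO 0 = 0"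
  using phiO_add[of 0 0] by simp

lemma phiO_const [simp]: "phiO [:f:] = ptw [] f"
  by (simp add: phiO_def)

lemma poly_shift_pCons: "poly_shift 1 (pCons c P) = P"
  by (simp add: poly_eq_iff coeff_poly_shift)

lemma phiO_pCons:
  "phiO (pCons c P) = ptw [] c + poly_scale (inverse (lam powi int n))
     (prepend (int n) (phiO (sh (- int n) P)) - poly_scale (wt (int n)) (phiO (sh (- int n) P)))
     - phiO (low (int n) P)"
proof -
  have "phiO (pCons c P) = phi0 (Suc (degree P)) (pCons c P)"
    by (rule phi0_eq_phiO[symmetric]) (rule degree_pCons_le)
  then show ?thesis
    by (simp add: poly_shift_pCons[simplified] phi0_eq_phiO degree_sh degree_low)
qed

text \<open>The equation holds on words themselves, before any relation is imposed, because the
  recursion of \<open>phi0\<close> was obtained by solving for it.\<close>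

lemma phiO_T: "phiO (T Q) = prepend (int n) (phiO Q)"
proof -
  let ?l = "lam powi int n"
  have inv: "inverse (lam ^ n) * (c * lam ^ n) = c" for c
    using lam by simp
  \<comment> \<open>On the first summand \<open>phiO_pCons\<close> undoes the shift; its
    \<open>low\<close> and weight terms cancel the other two summands.\<close>
  have "T Q = pCons 0 (smult [:?l:] (sh (int n) Q)) + smult [:?l:] (low (int n) (sh (int n) Q))
      + smult [:wt (int n):] Q"
    by (simp add: T_def D_def smult_add_right)
  also have "phiO \<dots> = prepend (int n) (phiO Q)"
    using lam
    by (simp only: phiO_add phiO_pCons phiO_smult sh_smult sh_sh low_smult prepend_poly_scale)
      (simp add: pw.scale_right_diff_distrib inv)
  finally show ?thesis .
qed

lemma fin_supp_phiO [simp]: "fin_supp (phiO P)"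
  by (induction P rule: T_induct) (auto simp: phiO_add phiO_smult phiO_T)

section \<open>Extension to \<open>\<Omega>\<close> tensored with words\<close>

primrec phi :: "int list \<Rightarrow> complex poly poly \<Rightarrow> int list \<Rightarrow> complex poly" where
  "phi [] P = phiO P"
| "phi (k # w) P = prepend k (phi w P) - phi w (D k P)"

lemma phi_add: "phi w (P + Q) = phi w P + phi w Q"
  by (induction w arbitrary: P Q) (simp_all add: phiO_add prepend_add D_add)

lemma additive_phi: "additive (phi w)"
  by unfold_locales (rule phi_add)

lemma phi_smult: "phi w (smult [:c:] P) = poly_scale c (phi w P)"
  by (induction w arbitrary: P)
    (simp_all add: phiO_smult prepend_poly_scale D_smult pw.scale_right_diff_distrib)

lemma fin_supp_phi [simp]: "fin_supp (phi w P)"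
  by (induction w arbitrary: P) simp_all

text \<open>The argument \<open>Y\<close> stands for the sum of \<open>Y w \<otimes> w\<close>, an
  element of \<open>\<Omega>\<close> tensored with words before the relations of V are
  imposed.\<close>

definition Phi :: "(int list \<Rightarrow> complex poly poly) \<Rightarrow> int list \<Rightarrow> complex poly" where
  "Phi = lin_ext phi"

lemmas Phi_add = lin_ext_add[of phi, OF additive_phi, folded Phi_def]
  and Phi_diff = lin_ext_diff[of phi, OF additive_phi, folded Phi_def]
  and Phi_sum = lin_ext_sum[of phi, OF additive_phi, folded Phi_def]
  and Phi_ptw = lin_ext_ptw[of phi, OF additive_phi, folded Phi_def]

lemma Phi_0 [simp]: "Phi 0 = 0"
  by (simp add: Phi_def)

lemma Phi_scale: "fin_supp Y \<Longrightarrow> Phi (\<lambda>w. smult [:c:] (Y w)) = poly_scale c (Phi Y)"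
  unfolding Phi_def
  by (rule lin_ext_scale)
    (auto simp: additive_phi phi_smult pw.scale_right_distrib intro!: additive.intro)

lemma fin_supp_Phi [simp]: "fin_supp Y \<Longrightarrow> fin_supp (Phi Y)"
  by (induction rule: fin_supp_induct) (auto simp: Phi_add Phi_ptw)

lemma D_comp_add: "(\<lambda>w. D k ((X + Y) w)) = (\<lambda>w. D k (X w)) + (\<lambda>w. D k (Y w))"
  by (auto simp: D_add fun_apply)

lemma Phi_prepend:
  "fin_supp Y \<Longrightarrow> Phi (prepend k Y) = prepend k (Phi Y) - Phi (\<lambda>w. D k (Y w))"
proof (induction rule: fin_supp_induct)
  case zero
  have "(\<lambda>w. D k ((0 :: int list \<Rightarrow> complex poly poly) w)) = 0" by (auto simp: fun_apply)
  then show ?case by simp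
next
  case (ptw w m)
  then show ?case by (simp add: prepend_ptw Phi_ptw ptw_comp)
next
  case (add x y)
  then show ?case unfolding D_comp_add by (simp add: prepend_add Phi_add)
qed

section \<open>The opposite map, from induced words to tensors\<close>

definition act :: "int \<Rightarrow> (int list \<Rightarrow> complex poly poly) \<Rightarrow> int list \<Rightarrow> complex poly poly" where
  "act k Y = (\<lambda>w. D k (Y w)) + prepend k Y"

lemma act_0 [simp]: "act k 0 = 0"
  by (auto simp: act_def fun_apply)

lemma act_add: "act k (X + Y) = act k X + act k Y"
  unfolding act_def D_comp_add by (simp add: prepend_add)

lemma act_ptw: "act k (ptw w P) = ptw w (D k P) + ptw (k # w) P"
  by (simp add: act_def ptw_comp prepend_ptw)

lemma fin_supp_act [simp]: "fin_supp Y \<Longrightarrow> fin_supp (act k Y)"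
  by (simp add: act_def)

lemma act_smult: "act k (\<lambda>w. smult [:c:] (Y w)) = (\<lambda>w. smult [:c:] (act k Y w))"
  by (auto simp: act_def D_smult prepend_comp smult_add_right fun_apply)

lemma Phi_act: "fin_supp Y \<Longrightarrow> Phi (act k Y) = prepend k (Phi Y)"
  by (simp add: act_def Phi_add Phi_prepend)

text \<open>\<open>psi w f\<close> is \<open>w (f \<otimes> 1)\<close>, where \<open>act\<close> is
  the tensor product action before passing to V.\<close>

primrec psi :: "int list \<Rightarrow> complex poly \<Rightarrow> int list \<Rightarrow> complex poly poly" where
  "psi [] f = ptw [] [:f:]"
| "psi (k # w) f = act k (psi w f)"

lemma additive_psi: "additive (psi w)"
proof
  show "psi w (f + g) = psi w f + psi w g" for f g
    by (induction w) (simp_all add: act_add flip: ptw_add)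
qed

lemma fin_supp_psi [simp]: "fin_supp (psi w f)"
  by (induction w) simp_all

lemma psi_smult: "psi w (smult c f) = (\<lambda>v. smult [:c:] (psi w f v))"
  by (induction w) (simp_all add: act_smult ptw_comp)

lemma Phi_psi: "Phi (psi w f) = ptw w f"
  by (induction w) (simp_all add: Phi_ptw Phi_act prepend_ptw)

definition lift :: "(int list \<Rightarrow> complex poly) \<Rightarrow> int list \<Rightarrow> complex poly poly" where
  "lift = lin_ext psi"

lemmas lift_add = lin_ext_add[of psi, OF additive_psi, folded lift_def]
  and lift_diff = lin_ext_diff[of psi, OF additive_psi, folded lift_def]
  and lift_ptw = lin_ext_ptw[of psi, OF additive_psi, folded lift_def]

lemma lift_0 [simp]: "lift 0 = 0"
  by (simp add: lift_def)

lemma lift_scale: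
  assumes "fin_supp x"
  shows "lift (poly_scale c x) = (\<lambda>w. smult [:c:] (lift x w))"
  unfolding lift_def poly_scale_def
  by (rule lin_ext_scale[where g = "\<lambda>Y w. smult [:c:] (Y w)"])
    (auto simp: additive_psi psi_smult assms smult_add_right fun_apply intro!: additive.intro)

lemma fin_supp_lift [simp]: "fin_supp x \<Longrightarrow> fin_supp (lift x)"
  by (induction rule: fin_supp_induct) (auto simp: lift_add lift_ptw)

text \<open>Both maps match \<open>act\<close> with prepending and agree on the empty word. Thus
  \<open>lift\<close> has the left inverse \<open>Phi\<close> already before quotients are taken;
  the kernel computation uses this.\<close>

lemma Phi_lift: "fin_supp x \<Longrightarrow> Phi (lift x) = x"
  by (induction rule: fin_supp_induct) (auto simp: lift_add lift_ptw Phi_psi Phi_add)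

lemma lift_prepend: "fin_supp x \<Longrightarrow> lift (prepend k x) = act k (lift x)"
  by (induction rule: fin_supp_induct)
    (auto simp: lift_add lift_ptw act_add prepend_add prepend_ptw)

lemma module_mult: "module ((*) :: complex \<Rightarrow> complex \<Rightarrow> complex)"
  by unfold_locales (auto simp: algebra_simps)

lemma module_smult: "module (smult :: complex \<Rightarrow> complex poly \<Rightarrow> complex poly)"
  by unfold_locales (auto simp: smult_add_right smult_add_left)

lemma module_smult2: "module (\<lambda>c :: complex. smult [:c:] :: complex poly poly \<Rightarrow> _)"
  by unfold_locales (auto simp: smult_add_right pCons_one mult.commute simp flip: smult_add_left)

lemma comm_rel_eq_span:
  "fin_supp x \<Longrightarrow> comm_rel smult \<theta> i j x \<in> I"
  using comm_rel_in_span[OF module_smult, of \<theta> "Ind_rels n a \<theta> lam \<alpha> h" x i j]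
  by (simp add: Ind_rels_def poly_scale_def[abs_def])

text \<open>The mixed terms with one \<open>D\<close> and one \<open>prepend\<close> cancel, and the
  terms in \<open>D\<close> alone cancel by \<open>D_comm\<close>. The word factor keeps the whole
  relation, central term included, since c acts as 0 on \<open>\<Omega>\<close>.\<close>

lemma lift_comm_rel:
  assumes "fin_supp x"
  shows "lift (comm_rel smult \<theta> i j x) = comm_rel (\<lambda>c. smult [:c:]) \<theta> i j (lift x)"
proof -
  let ?Y = "lift x"
  let ?c = "(of_int i ^ 3 - of_int i) / 12 * \<theta>"
  define Z where "Z = (\<lambda>w. smult [:of_int (j - i):] (?Y w))"
  have act2: "act i (act j ?Y) = (\<lambda>w. D i (D j (?Y w))) + prepend j (\<lambda>w. D i (?Y w))
      + prepend i (\<lambda>w. D j (?Y w)) + prepend i (prepend j ?Y)" for i j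
    unfolding act_def D_comp_add prepend_add by (simp add: prepend_comp add_ac)
  have D: "(\<lambda>w. D i (D j (?Y w))) = (\<lambda>w. D j (D i (?Y w))) + (\<lambda>w. D (i + j) (Z w))"
    using D_comm[of i j] by (auto simp: fun_apply Z_def D_smult diff_eq_eq add.commute)
  have fs: "fin_supp (\<lambda>w. smult c (x w))" for c
    using assms by simp
  have lift_smult: "lift (\<lambda>w. smult c (x w)) = (\<lambda>w. smult [:c:] (?Y w))" for c
    using lift_scale[OF assms] by (simp add: poly_scale_def)
  have lift_if: "lift (if i = - j then (\<lambda>w. smult ?c (x w)) else 0)
      = (if i = - j then (\<lambda>w. smult [:?c:] (?Y w)) else 0)"
    using lift_smult by simp
  have "lift (comm_rel smult \<theta> i j x) = act i (act j ?Y) - act j (act i ?Y) - act (i + j) Z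
     - (if i = - j then (\<lambda>w. smult [:?c:] (?Y w)) else 0)"
    unfolding comm_rel_def Z_def using assms fs
    by (subst lift_diff lift_if | simp add: lift_prepend lift_smult)+
  also have "\<dots> = comm_rel (\<lambda>c. smult [:c:]) \<theta> i j ?Y"
    unfolding act2 comm_rel_def D Z_def[symmetric]
    by (simp add: act_def algebra_simps)
  finally show ?thesis .
qed

lemma Ind_rel_in_I:
  "k \<ge> int n + 1 \<Longrightarrow> ptw (u @ [k]) f - ptw (u @ [int n]) (smult (lam powi (k - int n)) f)
     - ptw u (b_act n a lam \<alpha> h k f) \<in> I"
  by (rule pw.span_base) (auto simp: Ind_rels_def)

lemma prepend_I: "x \<in> I \<Longrightarrow> prepend k x \<in> I"
proof (rule pw.span_image_subset[where f = "prepend k"])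
  have "prepend k (ptw (u @ [l]) f - ptw (u @ [int n]) (smult (lam powi (l - int n)) f)
     - ptw u (b_act n a lam \<alpha> h l f)) \<in> I" if "l \<ge> int n + 1" for l u f
    using Ind_rel_in_I[OF that, of "k # u" f] by (simp add: prepend_diff prepend_ptw)
  moreover have "prepend k x \<in> I" if "x \<in> comm_rels smult \<theta>" for x
    by (rule pw.span_base) (simp add: Ind_rels_def that prepend_comm_rels)
  ultimately show "prepend k ` Ind_rels n a \<theta> lam \<alpha> h \<subseteq> I"
    unfolding Ind_rels_def[of n a \<theta> lam \<alpha> h] image_Un by blast
qed (auto simp: prepend_add prepend_poly_scale)

text \<open>On C[t] the two twisted operators have the same term in s, so their difference stays in
  C[t]; factoring \<open>k^2 - n^2\<close> gives the formula of \<open>b_act\<close>.\<close>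

lemma D_const_diff:
  "D k [:f:] + smult [:wt k:] [:f:]
    = smult [:lam powi (k - int n):] (T [:f:]) + [:b_act n a lam \<alpha> h k f:]"
proof -
  have p: "lam powi k = lam powi (k - int n) * lam ^ n"
    using lam by (simp add: power_int_diff)
  have "smult (lam powi k) (A k f) + smult (wt k) f
      = smult (lam powi (k - int n)) (smult (lam ^ n) (A (int n) f) + smult (wt (int n)) f)
        + b_act n a lam \<alpha> h k f"
    unfolding A_def b_act_def p
    by (rule poly_eqI) (simp add: algebra_simps power2_eq_square)
  then show ?thesis
    unfolding D_const T_def by (simp add: p mult_ac)
qed

text \<open>By induction along \<open>T_induct\<close>: commuting \<open>d\<^sub>k\<close> past \<open>d\<^sub>n\<close> only produces \<open>d\<^bsub>n+k\<^esub>\<close>,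
  which acts by weight \<open>0\<close>.\<close>

lemma phiO_hom:
  assumes "k \<ge> int n"
  shows "prepend k (phiO P) - phiO (D k P + smult [:wt k:] P) \<in> I"
proof (cases "k = int n")
  case True
  then show ?thesis using phiO_T[of P] by (simp add: T_def pw.span_zero)
next
  case False
  with assms have k: "k > int n" by simp
  define J where "J k P = prepend k (phiO P) - phiO (D k P + smult [:wt k:] P)" for k P
  have J_add: "J k (P + Q) = J k P + J k Q" for k P Q
    by (simp add: J_def prepend_add phiO_add D_add smult_add_right algebra_simps)
  have J_smult: "J k (smult [:c:] P) = poly_scale c (J k P)" for k c P
  proof -
    have "D k (smult [:c:] P) + smult [:wt k:] (smult [:c:] P)
        = smult [:c:] (D k P + smult [:wt k:] P)"
      by (simp add: D_smult smult_add_right mult.commute)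
    then show ?thesis
      unfolding J_def by (simp only: phiO_smult prepend_poly_scale pw.scale_right_diff_distrib)
  qed
  \<comment> \<open>All k at once, because the step for k uses the hypothesis at k + n.\<close>
  have "\<forall>k > int n. J k P \<in> I"
  proof (induction P rule: T_induct)
    case (const f)
    show ?case
    proof safe
      fix k assume "k > int n"
      then have "ptw ([] @ [k]) f - ptw ([] @ [int n]) (smult (lam powi (k - int n)) f)
          - ptw [] (b_act n a lam \<alpha> h k f) \<in> I"
        by (intro Ind_rel_in_I) simp
      then show "J k [:f:] \<in> I"
        unfolding J_def D_const_diff
        by (simp add: phiO_add phiO_smult phiO_T prepend_ptw poly_scale_ptw diff_diff_eq)
    qed
  next
    case (add P Q)
    then show ?case by (simp add: J_add pw.span_add)
  next
    case (smult c P)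
    then show ?case by (simp add: J_smult pw.span_scale)
  next
    case (T P)
    show ?case
    proof safe
      fix k assume k: "k > int n"
      let ?c = "of_int (int n - k)"
      \<comment> \<open>From k > n follow k + n > 2n, so the weight vanishes, and k \<noteq> -n, so
        the relation has no central term.\<close>
      have wt0: "wt (k + int n) = 0" using k by (simp add: a_ext_def)
      have ne: "k \<noteq> - int n" using k by simp
      have TD: "D k (T P) + smult [:wt k:] (T P) =
          T (D k P + smult [:wt k:] P) + smult [:?c:] (D (k + int n) P)"
        using D_comm[of k "int n" P]
        by (simp add: T_def D_add D_smult smult_add_right algebra_simps)
      \<comment> \<open>The defect of \<open>T P\<close> splits into a commutation relation, a
        prepended old defect, and the defect at k + n coming from the bracket.\<close>
      have eq: "J k (T P) = comm_rel smult \<theta> k (int n) (phiO P)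
          + prepend (int n) (J k P) + poly_scale ?c (J (k + int n) P)"
        unfolding J_def TD wt0 phiO_T phiO_add comm_rel_def prepend_diff
        using ne by (simp add: phiO_T phiO_smult prepend_add prepend_diff pw.scale_right_diff_distrib
           algebra_simps prepend_poly_scale flip: poly_scale_def)
      show "J k (T P) \<in> I"
        unfolding eq using T k by (intro pw.span_add pw.span_scale prepend_I comm_rel_eq_span) auto
    qed
  qed
  then show ?thesis using k by (simp add: J_def)
qed


lemma phi_hom: "k \<ge> int n \<Longrightarrow> phi [k] P - poly_scale (wt k) (phi [] P) \<in> I"
  using phiO_hom[of k P] by (simp add: phiO_add phiO_smult algebra_simps)

section \<open>Relations of V go to relations of the induced module\<close>

definition pure_tensor :: "(int list \<Rightarrow> complex) \<Rightarrow> complex poly poly \<Rightarrow> int list \<Rightarrow> complex poly poly" where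
  "pure_tensor y P = (\<lambda>w. smult [:y w:] P)"

lemma pure_tensor_add: "pure_tensor (x + y) P = pure_tensor x P + pure_tensor y P"
  by (auto simp: pure_tensor_def fun_apply smult_add_left[symmetric])

lemma pure_tensor_diff: "pure_tensor (x - y) P = pure_tensor x P - pure_tensor y P"
  by (auto simp: pure_tensor_def fun_apply smult_diff_left[symmetric])

lemma pure_tensor_ptw: "pure_tensor (ptw w c) P = ptw w (smult [:c:] P)"
  unfolding pure_tensor_def by (rule ptw_comp) simp

lemma pure_tensor_scale: "pure_tensor (\<lambda>w. c * y w) P = pure_tensor y (smult [:c:] P)"
  by (auto simp: pure_tensor_def mult.commute)

lemma pure_tensor_0 [simp]: "pure_tensor 0 P = 0"
  by (auto simp: pure_tensor_def fun_apply)

lemma pure_tensor_prepend: "pure_tensor (prepend k y) P = prepend k (pure_tensor y P)"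
  unfolding pure_tensor_def by (rule prepend_comp[symmetric]) simp

lemma fin_supp_pure_tensor [simp]: "fin_supp y \<Longrightarrow> fin_supp (pure_tensor y P)"
  unfolding pure_tensor_def by (rule fin_supp_comp) auto

lemma Phi_pure_tensor_prepend:
  "fin_supp y \<Longrightarrow> Phi (pure_tensor (prepend k y) P)
    = prepend k (Phi (pure_tensor y P)) - Phi (pure_tensor y (D k P))"
  by (simp add: pure_tensor_prepend Phi_prepend) (simp add: pure_tensor_def D_smult)

text \<open>Counterpart of \<open>lift_comm_rel\<close>: unfolding \<open>Phi\<close> over two
  letters produces mixed terms that cancel and a commutator of \<open>D\<close> that the bracket
  term absorbs.\<close>

lemma Phi_pure_tensor_comm_rel:
  assumes y: "fin_supp y"
  shows "Phi (pure_tensor (comm_rel (*) \<theta> i j y) P) = comm_rel smult \<theta> i j (Phi (pure_tensor y P))"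
proof -
  let ?c = "(of_int i ^ 3 - of_int i) / 12 * \<theta>"
  let ?y = "\<lambda>P. Phi (pure_tensor y P)"
  have scale: "?y (smult [:c:] P) = poly_scale c (?y P)" for c P
    using Phi_scale[OF fin_supp_pure_tensor[OF y], of c P] by (simp add: pure_tensor_def mult.commute)
  have add: "?y (P + Q) = ?y P + ?y Q" for P Q
  proof -
    have "pure_tensor y (P + Q) = pure_tensor y P + pure_tensor y Q"
      by (auto simp: pure_tensor_def smult_add_right fun_apply)
    then show ?thesis using y by (simp add: Phi_add)
  qed
  have D: "?y (D i (D j P)) = ?y (D j (D i P)) + poly_scale (of_int (j - i)) (?y (D (i + j) P))"
  proof -
    have "D i (D j P) = D j (D i P) + smult [:of_int (j - i):] (D (i + j) P)"
      using D_comm[of i j P] by (simp only: diff_eq_eq add.commute)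
    then show ?thesis by (simp only: add scale)
  qed
  define Z where "Z = (if i = - j then (\<lambda>w. ?c * y w) else 0)"
  define Z' where "Z' = (if i = - j then poly_scale ?c (?y P) else 0)"
  have "fin_supp (if b then (\<lambda>w. c * y w) else 0)" for b c
    using y by simp
  then have fin_Z: "fin_supp Z" unfolding Z_def .
  have Z: "Phi (pure_tensor Z P) = Z'"
    unfolding Z_def Z'_def
    by (cases "i = - j") (simp_all only: if_True if_False simp_thms pure_tensor_scale scale
        pure_tensor_0 Phi_0)
  have "Phi (pure_tensor (comm_rel (*) \<theta> i j y) P) =
    Phi (pure_tensor (prepend i (prepend j y)) P) - Phi (pure_tensor (prepend j (prepend i y)) P)
    - Phi (pure_tensor (prepend (i + j) (\<lambda>w. of_int (j - i) * y w)) P)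
    - Phi (pure_tensor Z P)"
    unfolding comm_rel_def Z_def[symmetric] using y fin_Z by (simp add: pure_tensor_diff Phi_diff)
  also have "\<dots> = prepend i (prepend j (?y P)) - prepend j (prepend i (?y P))
    - prepend (i + j) (poly_scale (of_int (j - i)) (?y P)) - Z'"
    using y by (simp add: Z Phi_pure_tensor_prepend pure_tensor_scale prepend_diff scale D
        D_smult del: of_int_diff)
  also have "\<dots> = comm_rel smult \<theta> i j (?y P)"
    by (simp only: comm_rel_def Z'_def poly_scale_def)
  finally show ?thesis .
qed

text \<open>Lets \<open>Phi\<close> descend to \<open>\<Omega> \<otimes> V\<close>. Only the weight
  relations at the generator need \<open>phi_hom\<close>; prefixes are added by prepending.\<close>

lemma Phi_pure_tensor_V_rels:
  assumes "y \<in> cw.span (V_rels n a \<theta>)"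
  shows "fin_supp y \<and> (\<forall>P. Phi (pure_tensor y P) \<in> I)"
proof -
  \<comment> \<open>All \<open>P\<close> are quantified inside \<open>K\<close>, since prepending k
    to \<open>y\<close> brings in \<open>D k P\<close> next to \<open>P\<close>.\<close>
  define K where "K = {y. fin_supp y \<and> (\<forall>P. Phi (pure_tensor y P) \<in> I)}"
  have prep: "prepend k y \<in> K" if "y \<in> K" for k y
    using that by (auto simp: K_def Phi_pure_tensor_prepend prepend_I intro!: pw.span_diff)
  have words: "ptw (u @ [i]) 1 - ptw u (wt i) \<in> K" if "i \<ge> int n" for u i
  proof (induction u)
    case Nil
    have "Phi (pure_tensor (ptw [i] 1 - ptw [] (wt i)) P) = phi [i] P - poly_scale (wt i) (phi [] P)" for P
      by (simp add: pure_tensor_diff pure_tensor_ptw Phi_diff Phi_ptw phi_smult pCons_one phiO_smult)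
    then show ?case using phi_hom[OF that] by (simp add: K_def)
  next
    case (Cons k u)
    from prep[OF this, of k] show ?case by (simp add: prepend_diff prepend_ptw)
  qed
  have "V_rels n a \<theta> \<subseteq> K"
  proof -
    have "comm_rel (*) \<theta> i j (ptw v m) \<in> K" for i j v m
      by (auto simp: K_def Phi_pure_tensor_comm_rel comm_rel_eq_span module_mult fin_supp_comm_rel)
    then have "comm_rels (*) \<theta> \<subseteq> K"
      by (intro comm_rels_subset prep module_mult)
    moreover have "ptw (u @ [i]) 1 - ptw u (a i) \<in> K" if "int n \<le> i" "i \<le> 2 * int n" for u i
      using words[of i u] that by (simp add: a_ext_def)
    moreover have "ptw (u @ [i]) 1 \<in> K" if "2 * int n < i" for u i
      using words[of i u] that by (simp add: a_ext_def)
    ultimately show ?thesis unfolding V_rels_def by blast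
  qed
  moreover have "cw.subspace K"
    by (auto simp: cw.subspace_def K_def pure_tensor_add pure_tensor_scale Phi_add pw.span_zero pw.span_add)
  ultimately have "cw.span (V_rels n a \<theta>) \<subseteq> K" by (rule cw.span_minimal)
  then show ?thesis using assms by (auto simp: K_def)
qed

end

section \<open>The isomorphism\<close>

locale omega_tensor = omega_ind lam \<alpha> h n a \<theta> + V: module scV
  for lam \<alpha> h n a \<theta> and scV :: "complex \<Rightarrow> 'v::ab_group_add \<Rightarrow> 'v" +
  fixes SV :: "'v set" and DV :: "int \<Rightarrow> 'v \<Rightarrow> 'v" and \<pi>V :: "(int list \<Rightarrow> complex) \<Rightarrow> 'v"
  assumes pres: "presents (\<lambda>c x w. c * x w) {x. fin_supp x} (V_rels n a \<theta>) scV SV prepend DV \<pi>V"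
begin

lemma
  shows piV_add: "\<And>x y. fin_supp x \<Longrightarrow> fin_supp y \<Longrightarrow> \<pi>V (x + y) = \<pi>V x + \<pi>V y"
    and piV_scale: "\<And>c x. fin_supp x \<Longrightarrow> \<pi>V (\<lambda>w. c * x w) = scV c (\<pi>V x)"
    and piV_image: "\<pi>V ` {x. fin_supp x} = SV"
    and piV_ker: "\<And>x. fin_supp x \<Longrightarrow> \<pi>V x = 0 \<longleftrightarrow> x \<in> cw.span (V_rels n a \<theta>)"
    and piV_act: "\<And>k x. fin_supp x \<Longrightarrow> \<pi>V (prepend k x) = DV k (\<pi>V x)"
  using pres unfolding presents_def by (fast, fast, fast, blast, fast)

lemma piV_0 [simp]: "\<pi>V 0 = 0"
  using piV_add[of 0 0] by simp

lemma piV_sum: "(\<And>i. i \<in> S \<Longrightarrow> fin_supp (x i)) \<Longrightarrow> \<pi>V (\<Sum>i\<in>S. x i) = (\<Sum>i\<in>S. \<pi>V (x i))"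
  by (induction S rule: infinite_finite_induct) (auto simp: piV_add)

lemma DV_0 [simp]: "DV k 0 = 0"
  using piV_act[of 0 k] by simp

section \<open>Coordinates with respect to the monomials t^a s^i\<close>

definition cf :: "nat \<times> nat \<Rightarrow> complex poly poly \<Rightarrow> complex" where
  "cf p P = coeff (coeff P (snd p)) (fst p)"

definition mon :: "nat \<times> nat \<Rightarrow> complex poly poly" where
  "mon p = monom (monom 1 (fst p)) (snd p)"

definition slice :: "nat \<times> nat \<Rightarrow> (int list \<Rightarrow> complex poly poly) \<Rightarrow> int list \<Rightarrow> complex" where
  "slice p Y = (\<lambda>w. cf p (Y w))"

text \<open>The identity of \<open>\<Omega>\<close> tensored with \<open>\<pi>V\<close>, computed
  coordinate by coordinate.\<close>

definition q :: "(int list \<Rightarrow> complex poly poly) \<Rightarrow> nat \<times> nat \<Rightarrow> 'v" where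
  "q Y = (\<lambda>p. \<pi>V (slice p Y))"

lemma cf_simps [simp]:
  "cf p 0 = 0" "cf p (P + Q) = cf p P + cf p Q" "cf p (P - Q) = cf p P - cf p Q"
  "cf p (smult [:c:] P) = c * cf p P"
  by (auto simp: cf_def)

lemma cf_sum: "cf p (\<Sum>i\<in>S. P i) = (\<Sum>i\<in>S. cf p (P i))"
  by (simp add: cf_def coeff_sum)

lemma cf_mon: "c * cf p (mon p') = (if p = p' then c else 0)"
  by (cases p; cases p') (auto simp: cf_def mon_def)

lemma cf_eqI: "(\<And>p. cf p P = cf p Q) \<Longrightarrow> P = Q"
  unfolding cf_def by (intro poly_eqI) (metis fst_conv snd_conv)

lemma finite_cf: "finite {p. cf p P \<noteq> 0}"
proof (rule finite_subset)
  show "{p. cf p P \<noteq> 0} \<subseteq> (\<Union>j\<in>{..degree P}. {..degree (coeff P j)} \<times> {j})"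
  proof
    fix p assume "p \<in> {p. cf p P \<noteq> 0}"
    then have "coeff (coeff P (snd p)) (fst p) \<noteq> 0" by (simp add: cf_def)
    then have "snd p \<le> degree P" "fst p \<le> degree (coeff P (snd p))"
      by (auto intro!: le_degree)
    then show "p \<in> (\<Union>j\<in>{..degree P}. {..degree (coeff P j)} \<times> {j})"
      by (cases p) auto
  qed
qed auto

lemma slice_0 [simp]: "slice p 0 = 0"
  by (auto simp: slice_def fun_apply)

lemma slice_add: "slice p (X + Y) = slice p X + slice p Y"
  by (auto simp: slice_def fun_apply)

lemma slice_diff: "slice p (X - Y) = slice p X - slice p Y"
  by (auto simp: slice_def fun_apply)

lemma slice_smult: "slice p (\<lambda>w. smult [:c:] (Y w)) = (\<lambda>w. c * slice p Y w)"
  by (auto simp: slice_def)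

lemma slice_ptw: "slice p (ptw w P) = ptw w (cf p P)"
  unfolding slice_def by (rule ptw_comp) simp

lemma slice_prepend: "slice p (prepend k Y) = prepend k (slice p Y)"
  unfolding slice_def by (rule prepend_comp[symmetric]) simp

lemma fin_supp_slice [simp]: "fin_supp Y \<Longrightarrow> fin_supp (slice p Y)"
  unfolding slice_def by (rule fin_supp_comp) auto

lemma finite_slices: "fin_supp Y \<Longrightarrow> finite {p. slice p Y \<noteq> 0}"
proof (rule finite_subset)
  show "{p. slice p Y \<noteq> 0} \<subseteq> (\<Union>w\<in>{w. Y w \<noteq> 0}. {p. cf p (Y w) \<noteq> 0})"
    by (force simp: slice_def fun_eq_iff fun_apply)
qed (auto simp: fin_supp_def finite_cf)

lemma slice_expand:
  assumes "finite S" "{p. slice p Y \<noteq> 0} \<subseteq> S"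
  shows "Y = (\<Sum>p\<in>S. pure_tensor (slice p Y) (mon p))"
proof
  fix w
  show "Y w = (\<Sum>p\<in>S. pure_tensor (slice p Y) (mon p)) w"
  proof (rule cf_eqI)
    fix p
    have "cf p (Y w) = (if p \<in> S then cf p (Y w) else 0)"
      using assms(2) by (auto simp: slice_def fun_eq_iff fun_apply)
    also have "\<dots> = (\<Sum>p'\<in>S. cf p' (Y w) * cf p (mon p'))"
      using assms(1) by (simp add: cf_mon)
    finally show "cf p (Y w) = cf p ((\<Sum>p\<in>S. pure_tensor (slice p Y) (mon p)) w)"
      by (simp add: sum_fun_apply cf_sum pure_tensor_def slice_def)
  qed
qed

lemma q_0 [simp]: "q 0 = 0"
  by (auto simp: q_def fun_apply)

lemma q_add: "fin_supp X \<Longrightarrow> fin_supp Y \<Longrightarrow> q (X + Y) = q X + q Y"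
  by (auto simp: q_def slice_add piV_add fun_apply)

lemma q_diff: "fin_supp X \<Longrightarrow> fin_supp Y \<Longrightarrow> q (X - Y) = q X - q Y"
  using q_add[of "X - Y" Y] by (simp add: algebra_simps)

lemma q_smult: "fin_supp Y \<Longrightarrow> q (\<lambda>w. smult [:c:] (Y w)) = tensor_scale scV c (q Y)"
  by (auto simp: q_def slice_smult piV_scale tensor_scale_def)

text \<open>The monomials are a basis of \<open>\<Omega>\<close>, so the kernel is
  \<open>\<Omega>\<close> tensored with the kernel of \<open>\<pi>V\<close> and can be tested slice
  by slice.\<close>

lemma q_eq_0_iff: "fin_supp Y \<Longrightarrow> q Y = 0 \<longleftrightarrow> (\<forall>p. slice p Y \<in> cw.span (V_rels n a \<theta>))"
  by (auto simp: q_def fun_eq_iff fun_apply piV_ker)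

lemma q_weight:
  assumes "k \<ge> int n"
  shows "q (ptw [k] P) = q (ptw [] (smult [:wt k:] P))"
proof -
  have "ptw [k] 1 - ptw [] (wt k) \<in> V_rels n a \<theta>"
    using assms by (auto simp: V_rels_def a_ext_def intro!: exI[of _ "[]"])
  then have "(\<lambda>w. c * (ptw [k] 1 - ptw [] (wt k)) w) \<in> cw.span (V_rels n a \<theta>)" for c
    by (intro cw.span_scale cw.span_base)
  moreover have "(\<lambda>w. c * (ptw [k] 1 - ptw [] (wt k)) w) = ptw [k] c - ptw [] (wt k * c)" for c
    by (auto simp: ptw_def fun_apply)
  ultimately have "q (ptw [k] P - ptw [] (smult [:wt k:] P)) = 0"
    by (simp add: q_eq_0_iff slice_diff slice_ptw)
  then show ?thesis by (simp add: q_diff)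
qed

lemma q_act:
  assumes Y: "fin_supp Y"
  shows "q (act k Y) = tensor_act lam \<alpha> h scV DV k (q Y)"
proof
  fix p
  \<comment> \<open>Nonzero slices, not nonzero values of \<open>q Y\<close>: a slice may vanish in
    V and still be needed to expand \<open>Y\<close>.\<close>
  define S where "S = {p. slice p Y \<noteq> 0}"
  have S: "finite S" unfolding S_def by (rule finite_slices) fact
  have sub: "{p. q Y p \<noteq> 0} \<subseteq> S" by (auto simp: q_def S_def)
  have tens: "tens scV (omega_act lam \<alpha> h k (monom 1 (fst p')) (snd p')) v p
      = scV (cf p (D k (mon p'))) v" for p' v
    by (simp add: tens_def D_monom cf_def mon_def split: prod.split)
  have "tensor_act lam \<alpha> h scV DV k (q Y) = (\<Sum>p'\<in>S.
        tens scV (omega_act lam \<alpha> h k (monom 1 (fst p')) (snd p')) (q Y p') + ptw p' (DV k (q Y p')))"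
    unfolding tensor_act_def using S sub
    by (intro sum.mono_neutral_left) (auto simp: tens_def fun_eq_iff fun_apply)
  then have "tensor_act lam \<alpha> h scV DV k (q Y) p =
      (\<Sum>p'\<in>S. scV (cf p (D k (mon p'))) (q Y p')) + (\<Sum>p'\<in>S. ptw p' (DV k (q Y p')) p)"
    by (simp add: sum_fun_apply fun_apply tens sum.distrib)
  also have "(\<Sum>p'\<in>S. ptw p' (DV k (q Y p')) p) = DV k (q Y p)"
  proof -
    have "q Y p = 0" if "p \<notin> S" using that sub by auto
    then show ?thesis using S by (auto simp: ptw_def)
  qed
  also have "DV k (q Y p) = \<pi>V (slice p (prepend k Y))"
    using Y by (simp add: q_def slice_prepend piV_act)
  also have "(\<Sum>p'\<in>S. scV (cf p (D k (mon p'))) (q Y p')) = \<pi>V (slice p (\<lambda>w. D k (Y w)))"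
  proof -
    have "slice p (\<lambda>w. D k (Y w)) = (\<Sum>p'\<in>S. (\<lambda>w. cf p (D k (mon p')) * slice p' Y w))"
    proof
      fix w
      have "Y w = (\<Sum>p'\<in>S. smult [:slice p' Y w:] (mon p'))"
        using slice_expand[OF S, of Y] unfolding S_def
        by (metis (no_types, lifting) pure_tensor_def sum.cong sum_fun_apply order_refl)
      moreover have "D k (\<Sum>p'\<in>S. P p') = (\<Sum>p'\<in>S. D k (P p'))" for P
        by (induction S rule: infinite_finite_induct) (auto simp: D_add)
      ultimately have "D k (Y w) = (\<Sum>p'\<in>S. smult [:slice p' Y w:] (D k (mon p')))"
        by (simp add: D_smult)
      then show "slice p (\<lambda>w. D k (Y w)) w = (\<Sum>p'\<in>S. (\<lambda>w. cf p (D k (mon p')) * slice p' Y w)) w"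
        by (simp add: slice_def[of p] cf_sum sum_fun_apply mult.commute)
    qed
    then show ?thesis using Y by (simp add: piV_sum piV_scale q_def)
  qed
  finally show "q (act k Y) p = tensor_act lam \<alpha> h scV DV k (q Y) p"
    using Y by (simp add: q_def act_def slice_add piV_add)
qed

lemma tensor_act_0 [simp]: "tensor_act lam \<alpha> h scV DV k 0 = 0"
  using q_act[of 0 k] by simp

section \<open>The map \<open>Psi\<close> and its surjectivity\<close>

definition Psi :: "(int list \<Rightarrow> complex poly) \<Rightarrow> nat \<times> nat \<Rightarrow> 'v" where
  "Psi x = q (lift x)"

lemma Psi_add: "fin_supp x \<Longrightarrow> fin_supp y \<Longrightarrow> Psi (x + y) = Psi x + Psi y"
  by (simp add: Psi_def lift_add q_add)

lemma Psi_diff: "fin_supp x \<Longrightarrow> fin_supp y \<Longrightarrow> Psi (x - y) = Psi x - Psi y"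
  by (simp add: Psi_def lift_diff q_diff)

lemma Psi_scale: "fin_supp x \<Longrightarrow> Psi (poly_scale c x) = tensor_scale scV c (Psi x)"
  by (simp add: Psi_def lift_scale q_smult)

lemma Psi_prepend: "fin_supp x \<Longrightarrow> Psi (prepend k x) = tensor_act lam \<alpha> h scV DV k (Psi x)"
  by (simp add: Psi_def lift_prepend q_act)

lemma q_act_ptw: "k \<ge> int n \<Longrightarrow> q (act k (ptw [] P)) = q (ptw [] (D k P + smult [:wt k:] P))"
  by (simp add: act_ptw q_add q_weight ptw_add)

text \<open>Both sides turn \<open>T\<close> into the action of \<open>d_n\<close>: the left by
  \<open>phiO_T\<close>, the right because \<open>d_n\<close> multiplies the generator of V by its
  weight.\<close>

lemma Psi_phiO: "Psi (phiO P) = q (ptw [] P)"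
proof (induction P rule: T_induct)
  case (const f)
  then show ?case by (simp add: Psi_def lift_ptw)
next
  case (add P Q)
  then show ?case by (simp add: phiO_add Psi_add ptw_add q_add)
next
  case (smult c P)
  have "q (ptw [] (smult [:c:] P)) = tensor_scale scV c (q (ptw [] P))"
    using q_smult[of "ptw [] P" c] by (simp add: ptw_comp)
  then show ?case using smult by (simp add: phiO_smult Psi_scale)
next
  case (T P)
  have "Psi (phiO (T P)) = q (act (int n) (ptw [] P))"
    by (simp only: phiO_T Psi_prepend fin_supp_phiO T q_act fin_supp_ptw)
  also have "\<dots> = q (ptw [] (T P))"
    by (simp add: q_act_ptw T_def)
  finally show ?case .
qed

lemma Psi_phi: "Psi (phi w P) = q (ptw w P)"
proof (induction w arbitrary: P)
  case Nil
  then show ?case by (simp add: Psi_phiO)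
next
  case (Cons k w)
  have "Psi (phi (k # w) P) = q (act k (ptw w P)) - q (ptw w (D k P))"
    by (simp add: Psi_diff Psi_prepend Cons q_act)
  then show ?case by (simp add: act_ptw q_add)
qed

text \<open>Shows that \<open>Phi\<close> supplies preimages under \<open>Psi\<close>, which gives
  surjectivity.\<close>

lemma Psi_Phi: "fin_supp Y \<Longrightarrow> Psi (Phi Y) = q Y"
  by (induction rule: fin_supp_induct)
    (auto simp: Phi_add Phi_ptw Psi_add Psi_phi q_add, simp add: Psi_def)

lemma fin_supp_q: "fin_supp Y \<Longrightarrow> fin_supp (q Y)"
  unfolding fin_supp_def[of "q Y"]
  by (rule finite_subset[OF _ finite_slices[of Y]]) (auto simp: q_def)

lemma Psi_image: "Psi ` {x. fin_supp x} = tensor_carrier SV"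
proof safe
  fix x :: "int list \<Rightarrow> complex poly" assume "fin_supp x"
  then show "Psi x \<in> tensor_carrier SV"
    using piV_image by (auto simp: tensor_carrier_def Psi_def fin_supp_q) (auto simp: q_def)
next
  fix X assume "X \<in> tensor_carrier SV"
  then have X: "fin_supp X" "\<And>p. \<exists>y. fin_supp y \<and> \<pi>V y = X p"
    using piV_image by (auto simp: tensor_carrier_def image_def set_eq_iff) metis
  then obtain y where y: "\<And>p. fin_supp (y p)" "\<And>p. \<pi>V (y p) = X p" by metis
  define S where "S = {p. X p \<noteq> 0}"
  have S: "finite S" using X(1) by (simp add: S_def fin_supp_def)
  \<comment> \<open>Word representatives of the coordinates of \<open>X\<close> assemble into
    \<open>Y\<close> with \<open>q Y = X\<close>; the preimage is then \<open>Phi Y\<close>.\<close>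
  define Y where "Y = (\<Sum>p\<in>S. pure_tensor (y p) (mon p))"
  have fin: "fin_supp Y" unfolding Y_def by (auto simp: y)
  have slice_Y: "slice p Y = (if p \<in> S then y p else 0)" for p
    using S by (auto simp: slice_def Y_def sum_fun_apply cf_sum pure_tensor_def cf_mon fun_eq_iff fun_apply)
  have "q Y = X"
    by (auto simp: q_def slice_Y y S_def fun_apply)
  then show "X \<in> Psi ` {x. fin_supp x}"
    using Psi_Phi[OF fin] fin by (auto intro!: image_eqI[of _ _ "Phi Y"])
qed

section \<open>The kernel of \<open>Psi\<close>\<close>

lemma slice_comm_rel: "slice p (comm_rel (\<lambda>c. smult [:c:]) \<theta> i j Y) = comm_rel (*) \<theta> i j (slice p Y)"
  by (auto simp: comm_rel_def slice_diff slice_prepend slice_smult)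

text \<open>Commutation relations lift to commutation relations, whose slices vanish in V. With
  empty prefix the remaining relations are \<open>D_const_diff\<close>, as \<open>d_k\<close> with k
  \<ge> n acts on \<open>f \<otimes> 1\<close> by its twisted operator.\<close>

lemma Ind_rels_subset_ker: "Ind_rels n a \<theta> lam \<alpha> h \<subseteq> {x. fin_supp x \<and> Psi x = 0}"
proof -
  let ?K = "{x. fin_supp x \<and> Psi x = 0}"
  have prep: "prepend k x \<in> ?K" if "x \<in> ?K" for k x
    using that by (simp add: Psi_prepend)
  have "Psi (comm_rel smult \<theta> i j x) = 0" if "fin_supp x" for i j x
  proof -
    have "fin_supp (comm_rel (\<lambda>c. smult [:c:]) \<theta> i j (lift x))"
      using that by (simp add: fin_supp_comm_rel module_smult2)
    moreover have "V_rels n a \<theta> \<supseteq> comm_rels (*) \<theta>" by (auto simp: V_rels_def)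
    ultimately show ?thesis
      using that comm_rel_in_span[OF module_mult, of \<theta> "V_rels n a \<theta>"]
      by (simp add: Psi_def lift_comm_rel q_eq_0_iff slice_comm_rel)
  qed
  then have "comm_rel smult \<theta> i j (ptw v m) \<in> ?K" for i j v m
    by (simp add: fin_supp_comm_rel module_smult)
  then have "comm_rels smult \<theta> \<subseteq> ?K"
    by (intro comm_rels_subset module_smult prep)
  moreover have "ptw (u @ [k]) f - ptw (u @ [int n]) (smult (lam powi (k - int n)) f)
     - ptw u (b_act n a lam \<alpha> h k f) \<in> ?K" if k: "k \<ge> int n + 1" for u k f
  proof (induction u)
    case Nil
    have q_psi: "Psi (ptw [k] f) = q (ptw [] (D k [:f:] + smult [:wt k:] [:f:]))" if "k \<ge> int n" for k f
      using that by (simp add: Psi_def lift_ptw q_act_ptw del: smult_pCons)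
    have "T [:smult c f:] = smult [:c:] (T [:f:])" for c
      using D_smult[of "int n" c "[:f:]"] by (simp add: T_def smult_add_right mult.commute)
    then have "D k [:f:] + smult [:wt k:] [:f:] = T [:smult (lam powi (k - int n)) f:]
       + [:b_act n a lam \<alpha> h k f:]"
      using D_const_diff[of k f] by simp
    then show ?case using k
      by (simp add: Psi_diff q_psi T_def[symmetric] ptw_add q_add Psi_def[of "ptw [] _"] lift_ptw
        del: smult_pCons)
  next
    case (Cons l u)
    from prep[OF this, of l] show ?case by (simp add: prepend_diff prepend_ptw)
  qed
  ultimately show ?thesis unfolding Ind_rels_def by blast
qed

text \<open>If \<open>Psi x = 0\<close>, the slices of \<open>lift x\<close> are relations of V.
  Expanding \<open>x = Phi (lift x)\<close> over monomials puts each summand into \<open>I\<close>;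
  the converse is the previous lemma.\<close>

lemma Psi_ker: "{x \<in> {x. fin_supp x}. Psi x = 0} = I"
proof safe
  fix x :: "int list \<Rightarrow> complex poly" assume x: "fin_supp x" "Psi x = 0"
  define S where "S = {p. slice p (lift x) \<noteq> 0}"
  have S: "finite S" unfolding S_def using x by (intro finite_slices) simp
  have "x = Phi (\<Sum>p\<in>S. pure_tensor (slice p (lift x)) (mon p))"
    using slice_expand[OF S, of "lift x"] Phi_lift[OF x(1)] by (simp add: S_def)
  also have "\<dots> = (\<Sum>p\<in>S. Phi (pure_tensor (slice p (lift x)) (mon p)))"
    using x by (intro Phi_sum) simp
  also have "\<dots> \<in> I"
    using x Phi_pure_tensor_V_rels by (intro pw.span_sum) (auto simp: Psi_def q_eq_0_iff)
  finally show "x \<in> I" .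
next
  have "pw.subspace {x. fin_supp x \<and> Psi x = 0}"
    by (auto simp: pw.subspace_def Psi_add Psi_scale tensor_scale_def fun_apply) (simp add: Psi_def)
  with Ind_rels_subset_ker have "I \<subseteq> {x. fin_supp x \<and> Psi x = 0}" by (rule pw.span_minimal)
  then show "\<And>x. x \<in> I \<Longrightarrow> fin_supp x" "\<And>x. x \<in> I \<Longrightarrow> Psi x = 0" by auto
qed

lemma presents_Psi:
  "presents poly_scale {x. fin_supp x} (Ind_rels n a \<theta> lam \<alpha> h) (tensor_scale scV)
     (tensor_carrier SV) prepend (tensor_act lam \<alpha> h scV DV) Psi"
  unfolding presents_def using Psi_add Psi_scale Psi_image Psi_ker Psi_prepend by auto

end

text \<open>V enters through an arbitrary presentation, so any model of it is covered. Presenting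
  the tensor product by the generators and relations of the induced module is the
  isomorphism.\<close>

theorem theorem5p2:
  fixes n :: nat and a :: "int \<Rightarrow> complex" and \<theta> lam \<alpha> \<xi> \<eta> :: complex
    and scV :: "complex \<Rightarrow> 'v::ab_group_add \<Rightarrow> 'v" and SV :: "'v set"
    and DV :: "int \<Rightarrow> 'v \<Rightarrow> 'v" and \<pi>V :: "(int list \<Rightarrow> complex) \<Rightarrow> 'v"
  assumes "lam \<noteq> 0" and "\<alpha> \<noteq> 0" and "\<xi> \<noteq> 0"
    and "module scV"
    and "presents (\<lambda>c x w. c * x w) {x. fin_supp x} (V_rels n a \<theta>) scV SV prepend DV \<pi>V"
  shows "\<exists>\<Psi>. presents poly_scale {x. fin_supp x} (Ind_rels n a \<theta> lam \<alpha> [:\<eta>, \<xi>:])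
            (tensor_scale scV) (tensor_carrier SV)
            prepend (tensor_act lam \<alpha> [:\<eta>, \<xi>:] scV DV) \<Psi>"
proof -
  interpret omega_tensor lam \<alpha> "[:\<eta>, \<xi>:]" n a \<theta> scV SV DV \<pi>V
    using assms by (simp add: omega_tensor_def omega_ind_def omega_def omega_tensor_axioms_def)
  show ?thesis using presents_Psi by blast
qed

end
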